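(* Let $p\ge1$. For every $t\ge0$ let $0<m_t\le L_t$, $\sigma_t\ge0$, $c_t\ge0$, $\alpha_t\ge0$. Consider the inexact online gradient descent iteration $x_{t+1}=x_t-\alpha_t(\nabla f_t(x_t)+v_t)$ in $\mathbb R^p$. For all $t$ assume: (i) $f_t\in\mathcal S(m_t,L_t)$ with global minimizer $x_t^*$; (ii) $\|x_{t+1}^*-x_t^*\|\le\sigma_t$; (iii) $\|v_t\|\le c_t$. If there exist non-negative scalars $(\rho_t,\lambda_t^{(1)},\lambda_t^{(2)},\lambda_t^{(3)})$ such that $$\begin{bmatrix}1-\rho_t^2-2\lambda_t^{(1)}L_tm_t & -\alpha_t+\lambda_t^{(1)}(L_t+m_t) & 1 & -\alpha_t\\ -\alpha_t+\lambda_t^{(1)}(L_t+m_t) & \alpha_t^2-2\lambda_t^{(1)} & -\alpha_t & \alpha_t^2\\ 1 & -\alpha_t & 1-\lambda_t^{(2)} & -\alpha_t\\ -\alpha_t & \alpha_t^2 & -\alpha_t & \alpha_t^2-\lambda_t^{(3)}\end{bmatrix}\preceq 0,$$ then $\|x_{t+1}-x_{t+1}^*\|^2\le\rho_t^2\|x_t-x_t^*\|^2+\lambda_t^{(2)}\sigma_t^2+\lambda_t^{(3)}c_t^2$.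
   Context: $\mathcal S(m,L)$ is the set of differentiable functions $f:\mathbb R^p\to\mathbb R$ having a unique global minimizer $x^*$ such that for all $x\in\mathbb R^p$ $$\begin{bmatrix}x-x^*\\ \nabla f(x)\end{bmatrix}^T\begin{bmatrix}-2mLI_p&(L+m)I_p\\(L+m)I_p&-2I_p\end{bmatrix}\begin{bmatrix}x-x^*\\ \nabla f(x)\end{bmatrix}\ge0.$$ $P\preceq0$ means the symmetric matrix $P$ is negative semidefinite; norms are Euclidean. *)

theory Defs
  imports "HOL-Analysis.Analysis"
begin

(* Unspecified at points where f is not differentiable. *)
definition gradient :: "('a::real_inner \<Rightarrow> real) \<Rightarrow> 'a \<Rightarrow> 'a" where
  "gradient f x = (THE g. GDERIV f x :> g)"

definition block_vec :: "real ^ 'm \<Rightarrow> real ^ 'n \<Rightarrow> real ^ ('m + 'n)" where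
  "block_vec u v = (\<chi> i. case i of Inl a \<Rightarrow> u $ a | Inr b \<Rightarrow> v $ b)"

definition block_mat ::
  "real ^ 'm ^ 'm \<Rightarrow> real ^ 'n ^ 'm \<Rightarrow> real ^ 'm ^ 'n \<Rightarrow> real ^ 'n ^ 'n
    \<Rightarrow> real ^ ('m + 'n) ^ ('m + 'n)" where
  "block_mat A B C D = (\<chi> i j.
     case i of
       Inl a \<Rightarrow> (case j of Inl a' \<Rightarrow> A $ a $ a' | Inr b \<Rightarrow> B $ a $ b)
     | Inr b \<Rightarrow> (case j of Inl a \<Rightarrow> C $ b $ a | Inr b' \<Rightarrow> D $ b $ b'))"

definition neg_semidef :: "real ^ 'n ^ 'n \<Rightarrow> bool" where
  "neg_semidef P \<longleftrightarrow> transpose P = P \<and> (\<forall>z. z \<bullet> (P *v z) \<le> 0)"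

abbreviation global_minimizer :: "('a \<Rightarrow> real) \<Rightarrow> 'a \<Rightarrow> bool" where
  "global_minimizer f x \<equiv> is_arg_min f (\<lambda>_. True) x"

(* The set S(m, L).  By uniqueness, the second quantifier over xs ranges over the single
   minimizer x*. *)
definition sector_class :: "real \<Rightarrow> real \<Rightarrow> (real ^ 'n \<Rightarrow> real) set" where
  "sector_class m L = {f.
     f differentiable_on UNIV \<and>
     (\<exists>!xs. global_minimizer f xs) \<and>
     (\<forall>xs. global_minimizer f xs \<longrightarrow>
       (\<forall>x. let z = block_vec (x - xs) (gradient f x) in
          z \<bullet> (block_mat
                 ((- 2 * m * L) *\<^sub>R mat 1) ((L + m) *\<^sub>R mat 1)
                 ((L + m) *\<^sub>R mat 1)       ((- 2) *\<^sub>R mat 1) *v z) \<ge> 0))}"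

(* The four coordinates correspond, in this order, to x_t - x_t*, grad f_t (x_t),
   x_t* - x_{t+1}* and v_t. *)
definition lmi_matrix ::
  "real \<Rightarrow> real \<Rightarrow> real \<Rightarrow> real \<Rightarrow> real \<Rightarrow> real \<Rightarrow> real \<Rightarrow> real ^ 4 ^ 4" where
  "lmi_matrix m L \<alpha> \<rho> lam1 lam2 lam3 = vector [
     vector [1 - \<rho>\<^sup>2 - 2 * lam1 * L * m, - \<alpha> + lam1 * (L + m), 1, - \<alpha>],
     vector [- \<alpha> + lam1 * (L + m), \<alpha>\<^sup>2 - 2 * lam1, - \<alpha>, \<alpha>\<^sup>2],
     vector [1, - \<alpha>, 1 - lam2, - \<alpha>],
     vector [- \<alpha>, \<alpha>\<^sup>2, - \<alpha>, \<alpha>\<^sup>2 - lam3]]"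

end

theory Submission
  imports Defs
begin

text \<open>
  Put \<open>a = x\<^sub>t - x\<^sub>t\<^sup>*\<close>, \<open>b = \<nabla>f\<^sub>t(x\<^sub>t)\<close>, \<open>w = x\<^sub>t\<^sup>* - x\<^sub>t\<^sub>+\<^sub>1\<^sup>*\<close> and \<open>d = v\<^sub>t\<close>, so that the
  new error is \<open>a - \<alpha> b + w - \<alpha> d\<close>. Evaluating the matrix inequality at the \<open>i\<close>-th components of
  \<open>(a, b, w, d)\<close> and summing over \<open>i\<close> gives a quadratic inequality between vectors (this replaces the
  Kronecker product with \<open>I\<^sub>p\<close>). The \<open>lam1\<close> term in it is \<open>lam1\<close> times the sector
  form at \<open>(a, b)\<close>, hence nonnegative, and can be dropped.
\<close>

lemma vector_4 [simp]:
  "(vector [w, x, y, z] :: ('a::zero)^4) $ 1 = w"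
  "(vector [w, x, y, z] :: ('a::zero)^4) $ 2 = x"
  "(vector [w, x, y, z] :: ('a::zero)^4) $ 3 = y"
  "(vector [w, x, y, z] :: ('a::zero)^4) $ 4 = z"
  unfolding vector_def by simp_all

lemma sum_UNIV_sum_type:
  fixes g :: "'m::finite + 'n::finite \<Rightarrow> 'a::comm_monoid_add"
  shows "(\<Sum>i\<in>UNIV. g i) = (\<Sum>a\<in>UNIV. g (Inl a)) + (\<Sum>b\<in>UNIV. g (Inr b))"
  \<comment> \<open>The default orientation of \<open>UNIV_Plus_UNIV\<close> would undo the
    splitting of the index set.\<close>
  by (simp add: UNIV_Plus_UNIV [symmetric] sum.Plus comp_def del: UNIV_Plus_UNIV)

lemma block_mat_mult_block_vec:
  "block_mat A B C D *v block_vec u v = block_vec (A *v u + B *v v) (C *v u + D *v v)"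
  by (simp add: vec_eq_iff block_mat_def block_vec_def matrix_vector_mult_def
      sum_UNIV_sum_type split: sum.split)

lemma inner_block_vec: "block_vec u v \<bullet> block_vec u' v' = u \<bullet> u' + v \<bullet> v'"
  by (simp add: inner_vec_def block_vec_def sum_UNIV_sum_type)

text \<open>Each block is a multiple of the identity and so acts by scaling; the two equal
  off-diagonal blocks give the factor 2 on the cross term.\<close>

lemma sector_class_ineq:
  assumes "f \<in> sector_class m L" and "global_minimizer f xs"
  shows "0 \<le> - 2 * m * L * ((x - xs) \<bullet> (x - xs)) + 2 * (L + m) * ((x - xs) \<bullet> gradient f x)
             - 2 * (gradient f x \<bullet> gradient f x)"
proof -
  define a where "a = x - xs"
  define b where "b = gradient f x"
  have "0 \<le> block_vec a b \<bullet> (block_mat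
                 ((- 2 * m * L) *\<^sub>R mat 1) ((L + m) *\<^sub>R mat 1)
                 ((L + m) *\<^sub>R mat 1)       ((- 2) *\<^sub>R mat 1) *v block_vec a b)"
    using assms unfolding sector_class_def Let_def a_def b_def by blast
  also have "\<dots> = - 2 * m * L * (a \<bullet> a) + 2 * (L + m) * (a \<bullet> b) - 2 * (b \<bullet> b)"
    unfolding block_mat_mult_block_vec inner_block_vec scaleR_matrix_vector_assoc [symmetric]
      matrix_vector_mul_lid
    by (simp add: inner_add_right inner_commute [of b a] algebra_simps)
  finally show ?thesis
    unfolding a_def b_def .
qed

text \<open>With \<open>u = (1, -\<alpha>, 1, -\<alpha>)\<close>, the matrix is the outer product of
  \<open>u\<close> with itself, minus the diagonal matrix of
  \<open>(\<rho>\<^sup>2, 0, lam2, lam3)\<close>, plus \<open>lam1\<close> times the scalar sector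
  matrix on the first two coordinates.\<close>

lemma lmi_matrix_quadratic_form:
  "vector [a, b, w, d] \<bullet> (lmi_matrix m L \<alpha> \<rho> lam1 lam2 lam3 *v vector [a, b, w, d])
    = (a - \<alpha> * b + w - \<alpha> * d)\<^sup>2 - \<rho>\<^sup>2 * a\<^sup>2 - lam2 * w\<^sup>2 - lam3 * d\<^sup>2
      + lam1 * (- 2 * m * L * a\<^sup>2 + 2 * (L + m) * (a * b) - 2 * b\<^sup>2)"
  by (simp add: lmi_matrix_def inner_vec_def matrix_vector_mult_def sum_4
      power2_eq_square algebra_simps)

lemma neg_semidef_lmi_matrix_vectors:
  fixes a b w d :: "real ^ 'p"
  assumes "neg_semidef (lmi_matrix m L \<alpha> \<rho> lam1 lam2 lam3)"
  shows "(norm (a - \<alpha> *\<^sub>R b + w - \<alpha> *\<^sub>R d))\<^sup>2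
      + lam1 * (- 2 * m * L * (a \<bullet> a) + 2 * (L + m) * (a \<bullet> b) - 2 * (b \<bullet> b))
    \<le> \<rho>\<^sup>2 * (norm a)\<^sup>2 + lam2 * (norm w)\<^sup>2 + lam3 * (norm d)\<^sup>2"
proof -
  have "(\<Sum>i\<in>UNIV. (a $ i - \<alpha> * b $ i + w $ i - \<alpha> * d $ i)\<^sup>2
      + lam1 * (- 2 * m * L * (a $ i)\<^sup>2 + 2 * (L + m) * (a $ i * b $ i) - 2 * (b $ i)\<^sup>2))
    \<le> (\<Sum>i\<in>UNIV. \<rho>\<^sup>2 * (a $ i)\<^sup>2 + lam2 * (w $ i)\<^sup>2 + lam3 * (d $ i)\<^sup>2)"
  proof (rule sum_mono)
    fix i
    have "vector [a $ i, b $ i, w $ i, d $ i] \<bullet>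
        (lmi_matrix m L \<alpha> \<rho> lam1 lam2 lam3 *v vector [a $ i, b $ i, w $ i, d $ i]) \<le> 0"
      using assms by (simp add: neg_semidef_def)
    then show "(a $ i - \<alpha> * b $ i + w $ i - \<alpha> * d $ i)\<^sup>2
        + lam1 * (- 2 * m * L * (a $ i)\<^sup>2 + 2 * (L + m) * (a $ i * b $ i) - 2 * (b $ i)\<^sup>2)
      \<le> \<rho>\<^sup>2 * (a $ i)\<^sup>2 + lam2 * (w $ i)\<^sup>2 + lam3 * (d $ i)\<^sup>2"
      unfolding lmi_matrix_quadratic_form by linarith
  qed
  \<comment> \<open>Squared norms and inner products are coordinate sums, so only the constants have
    to be pulled out.\<close>
  then show ?thesis
    unfolding power2_norm_eq_inner inner_vec_def
    by (simp add: sum.distrib sum_subtractf sum_distrib_left [symmetric] power2_eq_square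
        mult.assoc)
qed

theorem lemma3p1:
  fixes f :: "nat \<Rightarrow> real ^ 'p \<Rightarrow> real"
    and x xstar v :: "nat \<Rightarrow> real ^ 'p"
    and m L \<sigma> c \<alpha> :: "nat \<Rightarrow> real"
  assumes "\<And>t. 0 < m t" and "\<And>t. m t \<le> L t"
    and "\<And>t. 0 \<le> \<sigma> t" and "\<And>t. 0 \<le> c t" and "\<And>t. 0 \<le> \<alpha> t"
    and "\<And>t. x (Suc t) = x t - \<alpha> t *\<^sub>R (gradient (f t) (x t) + v t)"
    and "\<And>t. f t \<in> sector_class (m t) (L t)"
    and "\<And>t. global_minimizer (f t) (xstar t)"
    and "\<And>t. norm (xstar (Suc t) - xstar t) \<le> \<sigma> t"
    and "\<And>t. norm (v t) \<le> c t"
  shows "\<forall>t \<rho> lam1 lam2 lam3.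
    \<rho> \<ge> 0 \<and> lam1 \<ge> 0 \<and> lam2 \<ge> 0 \<and> lam3 \<ge> 0 \<and>
    neg_semidef (lmi_matrix (m t) (L t) (\<alpha> t) \<rho> lam1 lam2 lam3) \<longrightarrow>
    (norm (x (Suc t) - xstar (Suc t)))\<^sup>2
      \<le> \<rho>\<^sup>2 * (norm (x t - xstar t))\<^sup>2 + lam2 * (\<sigma> t)\<^sup>2 + lam3 * (c t)\<^sup>2"
proof (intro allI impI, elim conjE)
  fix t \<rho> lam1 lam2 lam3
  assume "0 \<le> \<rho>" and nonneg: "0 \<le> lam1" "0 \<le> lam2" "0 \<le> lam3"
    and lmi: "neg_semidef (lmi_matrix (m t) (L t) (\<alpha> t) \<rho> lam1 lam2 lam3)"
  let ?a = "x t - xstar t" and ?b = "gradient (f t) (x t)" and ?w = "xstar t - xstar (Suc t)"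
  \<comment> \<open>Adding and subtracting \<open>xstar t\<close> separates the drift
    \<open>?w\<close> of the minimizer from the old error.\<close>
  have step: "x (Suc t) - xstar (Suc t) = ?a - \<alpha> t *\<^sub>R ?b + ?w - \<alpha> t *\<^sub>R v t"
    by (simp add: assms(6) scaleR_add_right)
  have sector: "0 \<le> lam1 * (- 2 * m t * L t * (?a \<bullet> ?a) + 2 * (L t + m t) * (?a \<bullet> ?b)
      - 2 * (?b \<bullet> ?b))"
    \<comment> \<open>\<open>rotated\<close> swaps the two premises to match the order of the
      chained facts.\<close>
    using sector_class_ineq [OF assms(7,8)] nonneg(1) by (rule mult_nonneg_nonneg [rotated])
  have "norm ?w \<le> \<sigma> t"
    using assms(9) by (simp add: norm_minus_commute)
  \<comment> \<open>Nonnegative multipliers allow the norms of drift and noise to be replaced by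
    their bounds.\<close>
  then have "lam2 * (norm ?w)\<^sup>2 \<le> lam2 * (\<sigma> t)\<^sup>2"
    using nonneg(2) by (intro mult_left_mono power_mono) auto
  moreover have "lam3 * (norm (v t))\<^sup>2 \<le> lam3 * (c t)\<^sup>2"
    using nonneg(3) assms(10) by (intro mult_left_mono power_mono) auto
  ultimately show "(norm (x (Suc t) - xstar (Suc t)))\<^sup>2
      \<le> \<rho>\<^sup>2 * (norm ?a)\<^sup>2 + lam2 * (\<sigma> t)\<^sup>2 + lam3 * (c t)\<^sup>2"
    using neg_semidef_lmi_matrix_vectors [OF lmi, of ?a ?b ?w "v t"] sector
    unfolding step by linarith
qed

end
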